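(* Let $0<\mu\le\eta\le1$, let $k\ge1$ and let $1\le k'\le k$ be integers. Let $R$ be any rank-safe top-$k$ retrieval algorithm. Run ASC with parameters $(\mu,\eta)$ and Anytime$^*$ with parameter $\mu$, both without a time budget, with retrieval depth $k$ on the same query and document collection. Then $$Avg(k',ASC)\ \ge\ \mu\, Avg(k',R)\qquad\text{and}\qquad Avg(k',Anytime^* )\ \ge\ \mu\, Avg(k',R).$$
   Context: A finite collection of at least $k$ documents is given. For every document $d$ and term $t$ there is a weight $w_{t,d}\ge0$. For a query $Q$ (a finite set of terms), $RankScore(d)=\sum_{t\in Q}w_{t,d}$. A top-$k$ retrieval algorithm returns a list of $k$ documents ranked by non-increasing $RankScore$. It is rank-safe if the returned documents are $k$ highest-scoring documents of the collection. For an algorithm $A$ and integer $x\le k$, $Avg(x,A)$ is the average $RankScore$ of the first $x$ documents in the list returned by $A$. The collection is partitioned into non-empty clusters $C_1,\dots,C_m$, and each $C_i$ is subdivided into $n\ge1$ disjoint segments $S_{i,1},\dots,S_{i,n}$ with union $C_i$ (a maximum of weights over an empty segment is $0$). Define $$BoundSum(C_i)=\sum_{t\in Q}\max_{d\in C_i}w_{t,d},\qquad B_{i,j}=\sum_{t\in Q}\max_{d\in S_{i,j}}w_{t,d},$$ $$MaxSBound(C_i)=\max_{1\le j\le n}B_{i,j},\qquad AvgSBound(C_i)=\frac1n\sum_{j=1}^nB_{i,j}.$$ For each document $d$, the underlying retrieval method supplies on the fly an upper bound $Bound(d)\ge RankScore(d)$. Both ASC and Anytime$^*$ visit the clusters one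 by one, in non-increasing order of their estimated cluster upper bounds ($MaxSBound$ for ASC, $BoundSum$ for Anytime$^*$). Throughout, $\theta$ denotes the current top-$k$ threshold, i.e. the $k$-th highest rank score among the documents scored so far; nothing is pruned while fewer than $k$ documents have been scored. When a cluster $C_i$ is reached, it is either pruned (none of its documents is scored) or its documents are considered one after another, each being either pruned or scored (its exact $RankScore$ is computed). The final output is a list of the $k$ highest-scoring documents among all scored documents. Pruning rules of ASC with parameters $0<\mu\le\eta\le1$: cluster $C_i$ is pruned iff $MaxSBound(C_i)\le\theta/\mu$ and $AvgSBound(C_i)\le\theta/\eta$; a document $d$ in a non-pruned cluster is pruned iff $Bound(d)\le\theta/\eta$. Pruning rules of Anytime$^*$ with parameter $0<\mu\le1$: cluster $C_i$ is pruned iff $BoundSum(C_i)\le\theta/\mu$; a document $d$ in a non-pruned cluster is pruned iff $Bound(d)\le\theta/\mu$. *)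

theory Defs
  imports Complex_Main "HOL-Library.Disjoint_Sets"
begin

definition rank_score :: "'t set \<Rightarrow> ('t \<Rightarrow> 'd \<Rightarrow> real) \<Rightarrow> 'd \<Rightarrow> real" where
  "rank_score Q w d = (\<Sum>t\<in>Q. w t d)"

definition max_weight :: "('t \<Rightarrow> 'd \<Rightarrow> real) \<Rightarrow> 't \<Rightarrow> 'd set \<Rightarrow> real" where
  "max_weight w t X = (if X = {} then 0 else Max (w t ` X))"

text \<open>For a whole cluster this is \<open>BoundSum\<close>, for a segment it is \<open>B\<^sub>i\<^sub>j\<close>.\<close>

definition bound_sum :: "'t set \<Rightarrow> ('t \<Rightarrow> 'd \<Rightarrow> real) \<Rightarrow> 'd set \<Rightarrow> real" where
  "bound_sum Q w X = (\<Sum>t\<in>Q. max_weight w t X)"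

text \<open>The argument \<open>Si\<close> is the family of segments \<open>Si 1, \<dots>, Si n\<close> of a single cluster.\<close>

definition max_sbound :: "'t set \<Rightarrow> ('t \<Rightarrow> 'd \<Rightarrow> real) \<Rightarrow> nat \<Rightarrow> (nat \<Rightarrow> 'd set) \<Rightarrow> real" where
  "max_sbound Q w n Si = Max ((\<lambda>j. bound_sum Q w (Si j)) ` {1..n})"

definition avg_sbound :: "'t set \<Rightarrow> ('t \<Rightarrow> 'd \<Rightarrow> real) \<Rightarrow> nat \<Rightarrow> (nat \<Rightarrow> 'd set) \<Rightarrow> real" where
  "avg_sbound Q w n Si = (\<Sum>j=1..n. bound_sum Q w (Si j)) / real n"

text \<open>\<open>L\<close> ranks \<open>k\<close> highest-scoring elements of \<open>X\<close>; ties are broken arbitrarily.\<close>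

definition is_top_list :: "nat \<Rightarrow> ('d \<Rightarrow> real) \<Rightarrow> 'd set \<Rightarrow> 'd list \<Rightarrow> bool" where
  "is_top_list k s X L \<longleftrightarrow>
     length L = k \<and> distinct L \<and> set L \<subseteq> X \<and>
     sorted_wrt (\<lambda>d e. s d \<ge> s e) L \<and>
     (\<forall>d \<in> set L. \<forall>e \<in> X - set L. s e \<le> s d)"

definition avg_score :: "('d \<Rightarrow> real) \<Rightarrow> nat \<Rightarrow> 'd list \<Rightarrow> real" where
  "avg_score s x L = (\<Sum>d\<leftarrow>take x L. s d) / real x"

text \<open>The state of a run is the list of documents scored so far. The threshold, their
  \<open>k\<close>-th highest score, is only meaningful (and only consulted) once this list has at
  least \<open>k\<close> elements.\<close>

definition threshold :: "nat \<Rightarrow> ('d \<Rightarrow> real) \<Rightarrow> 'd list \<Rightarrow> real" where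
  "threshold k s scored = rev (sort (map s scored)) ! (k - 1)"

definition consider_doc ::
  "nat \<Rightarrow> ('d \<Rightarrow> real) \<Rightarrow> ('d \<Rightarrow> real \<Rightarrow> bool) \<Rightarrow> 'd \<Rightarrow> 'd list \<Rightarrow> 'd list" where
  "consider_doc k s prune_doc d scored =
     (if k \<le> length scored \<and> prune_doc d (threshold k s scored)
      then scored else scored @ [d])"

definition visit_cluster ::
  "nat \<Rightarrow> ('d \<Rightarrow> real) \<Rightarrow> (nat \<Rightarrow> real \<Rightarrow> bool) \<Rightarrow> ('d \<Rightarrow> real \<Rightarrow> bool) \<Rightarrow>
   (nat \<Rightarrow> 'd list) \<Rightarrow> nat \<Rightarrow> 'd list \<Rightarrow> 'd list" where
  "visit_cluster k s prune_cluster prune_doc docs i scored =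
     (if k \<le> length scored \<and> prune_cluster i (threshold k s scored)
      then scored else fold (consider_doc k s prune_doc) (docs i) scored)"

text \<open>\<open>L\<close> is a possible output of a run that visits the clusters \<open>C 1, \<dots>, C m\<close> by
  non-increasing estimate \<open>est\<close>. The existential quantifiers leave open how ties between
  clusters are broken (\<open>order\<close>) and in which order the documents of a cluster are
  considered (\<open>docs\<close>). The second argument of both pruning rules is the current
  threshold.\<close>

definition cluster_run_output ::
  "nat \<Rightarrow> ('d \<Rightarrow> real) \<Rightarrow> nat \<Rightarrow> (nat \<Rightarrow> 'd set) \<Rightarrow> (nat \<Rightarrow> real) \<Rightarrow>
   (nat \<Rightarrow> real \<Rightarrow> bool) \<Rightarrow> ('d \<Rightarrow> real \<Rightarrow> bool) \<Rightarrow> 'd list \<Rightarrow> bool" where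
  "cluster_run_output k s m C est prune_cluster prune_doc L \<longleftrightarrow>
     (\<exists>order docs.
        distinct order \<and> set order = {1..m} \<and>
        sorted_wrt (\<lambda>i j. est i \<ge> est j) order \<and>
        (\<forall>i\<in>{1..m}. distinct (docs i) \<and> set (docs i) = C i) \<and>
        is_top_list k s
          (set (fold (visit_cluster k s prune_cluster prune_doc docs) order [])) L)"

text \<open>A run considers each document at most once, so the bounds supplied on the fly during the
  run form a single function \<open>bound\<close>, even if they depend on the state of the run.\<close>

definition asc_output ::
  "nat \<Rightarrow> real \<Rightarrow> real \<Rightarrow> 't set \<Rightarrow> ('t \<Rightarrow> 'd \<Rightarrow> real) \<Rightarrow> ('d \<Rightarrow> real) \<Rightarrow>
   nat \<Rightarrow> (nat \<Rightarrow> 'd set) \<Rightarrow> nat \<Rightarrow> (nat \<Rightarrow> nat \<Rightarrow> 'd set) \<Rightarrow> 'd list \<Rightarrow> bool" where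
  "asc_output k \<mu> \<eta> Q w bound m C n S L \<longleftrightarrow>
     cluster_run_output k (rank_score Q w) m C
       (\<lambda>i. max_sbound Q w n (S i))
       (\<lambda>i \<theta>. max_sbound Q w n (S i) \<le> \<theta> / \<mu> \<and> avg_sbound Q w n (S i) \<le> \<theta> / \<eta>)
       (\<lambda>d \<theta>. bound d \<le> \<theta> / \<eta>) L"

definition anytime_output ::
  "nat \<Rightarrow> real \<Rightarrow> 't set \<Rightarrow> ('t \<Rightarrow> 'd \<Rightarrow> real) \<Rightarrow> ('d \<Rightarrow> real) \<Rightarrow>
   nat \<Rightarrow> (nat \<Rightarrow> 'd set) \<Rightarrow> 'd list \<Rightarrow> bool" where
  "anytime_output k \<mu> Q w bound m C L \<longleftrightarrow>
     cluster_run_output k (rank_score Q w) m C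
       (\<lambda>i. bound_sum Q w (C i))
       (\<lambda>i \<theta>. bound_sum Q w (C i) \<le> \<theta> / \<mu>)
       (\<lambda>d \<theta>. bound d \<le> \<theta> / \<mu>) L"

text \<open>The two output predicates are satisfiable: a run always scores at least \<open>k\<close> documents,
  so it does return a list of length \<open>k\<close>.\<close>

lemma is_top_list_exists:
  assumes "finite X" and "k \<le> card X"
  shows "\<exists>L. is_top_list k s X L"
proof -
  obtain xs where xs: "set xs = X" "distinct xs"
    using finite_distinct_list[OF assms(1)] by blast
  define ys where "ys = sort_key (\<lambda>d. - s d) xs"
  have ys: "set ys = X" "distinct ys" "length ys = card X"
    using xs distinct_card[of xs] by (auto simp: ys_def)
  have "sorted (map (\<lambda>d. - s d) ys)"
    by (simp add: ys_def)
  then have srt: "sorted_wrt (\<lambda>d e. s d \<ge> s e) ys"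
    by (simp add: sorted_map)
  have split: "ys = take k ys @ drop k ys"
    by simp
  have ss: "sorted_wrt (\<lambda>d e. s d \<ge> s e) (take k ys @ drop k ys)"
    using srt by simp
  have "set (take k ys) \<union> set (drop k ys) = X"
    using ys(1) split by (metis set_append)
  then have "is_top_list k s X (take k ys)"
    using ss ys assms(2) set_take_subset[of k ys]
    unfolding is_top_list_def sorted_wrt_append by auto
  then show ?thesis by blast
qed

lemma consider_doc_fold_mono:
  "length scored \<le> length (fold (consider_doc k s P) ds scored)"
proof (induction ds arbitrary: scored)
  case (Cons d ds)
  have "length scored \<le> length (consider_doc k s P d scored)"
    by (simp add: consider_doc_def)
  also have "\<dots> \<le> length (fold (consider_doc k s P) (d # ds) scored)"
    using Cons.IH by simp
  finally show ?case .
qed simp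

lemma consider_doc_fold_length:
  "min k (length scored + length ds) \<le> length (fold (consider_doc k s P) ds scored)"
proof (induction ds arbitrary: scored)
  case (Cons d ds)
  show ?case
  proof (cases "k \<le> length scored")
    case True
    then show ?thesis
      using consider_doc_fold_mono[of scored k s P "d # ds"] by linarith
  next
    case False
    then show ?thesis
      using Cons.IH[of "scored @ [d]"] by (simp add: consider_doc_def)
  qed
qed simp

lemma consider_doc_fold_distinct:
  "distinct scored \<Longrightarrow> distinct ds \<Longrightarrow> set scored \<inter> set ds = {} \<Longrightarrow>
   distinct (fold (consider_doc k s P) ds scored) \<and>
   set (fold (consider_doc k s P) ds scored) \<subseteq> set scored \<union> set ds"
proof (induction ds arbitrary: scored)
  case Nil
  then show ?case by simp
next
  case (Cons d ds)
  have "distinct (consider_doc k s P d scored)"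
    "set (consider_doc k s P d scored) \<inter> set ds = {}"
    "set (consider_doc k s P d scored) \<subseteq> insert d (set scored)"
    using Cons.prems by (auto simp: consider_doc_def)
  then show ?case
    using Cons.IH[of "consider_doc k s P d scored"] Cons.prems by fastforce
qed

lemma visit_cluster_fold:
  assumes "distinct scored" "distinct order"
    and "\<And>i. i \<in> set order \<Longrightarrow> distinct (docs i)"
    and "\<And>i. i \<in> set order \<Longrightarrow> set scored \<inter> set (docs i) = {}"
    and "disjoint_family_on (\<lambda>i. set (docs i)) (set order)"
  shows "distinct (fold (visit_cluster k s P P' docs) order scored) \<and>
    min k (length scored + (\<Sum>i\<leftarrow>order. length (docs i)))
      \<le> length (fold (visit_cluster k s P P' docs) order scored)"
  using assms
proof (induction order arbitrary: scored)
  case Nil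
  then show ?case by simp
next
  case (Cons i order)
  define v where "v = visit_cluster k s P P' docs i scored"
  have v: "distinct v" "set v \<subseteq> set scored \<union> set (docs i)"
    using consider_doc_fold_distinct[of scored "docs i" k s P'] Cons.prems
    by (auto simp: v_def visit_cluster_def)
  have len: "min k (length scored + length (docs i)) \<le> length v"
    using consider_doc_fold_length[of k scored "docs i" s P']
    by (auto simp: v_def visit_cluster_def)
  have "set v \<inter> set (docs j) = {}" if "j \<in> set order" for j
  proof -
    have "j \<noteq> i" using that Cons.prems(2) by auto
    then have "set (docs i) \<inter> set (docs j) = {}"
      using Cons.prems(5) that by (auto simp: disjoint_family_on_def)
    then show ?thesis
      using v(2) Cons.prems(4)[of j] that by auto
  qed
  moreover have "disjoint_family_on (\<lambda>i. set (docs i)) (set order)"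
    using Cons.prems(5) by (auto simp: disjoint_family_on_def)
  ultimately have "distinct (fold (visit_cluster k s P P' docs) order v) \<and>
    min k (length v + (\<Sum>i\<leftarrow>order. length (docs i)))
      \<le> length (fold (visit_cluster k s P P' docs) order v)"
    using Cons.IH[of v] v(1) Cons.prems by auto
  then show ?case
    using len by (auto simp: v_def)
qed

lemma cluster_run_output_exists:
  assumes "finite D" and "k \<le> card D"
    and "disjoint_family_on C {1..m}" and "(\<Union>i\<in>{1..m}. C i) = D"
  shows "\<exists>L. cluster_run_output k s m C est P P' L"
proof -
  define order where "order = sort_key (\<lambda>i. - est i) [1..<Suc m]"
  have order: "distinct order" "set order = {1..m}"
    by (auto simp: order_def)
  have "sorted (map (\<lambda>i. - est i) order)"
    by (simp add: order_def del: upt_Suc)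
  then have srt: "sorted_wrt (\<lambda>i j. est i \<ge> est j) order"
    by (simp add: sorted_map)
  have fin: "finite (C i)" if "i \<in> {1..m}" for i
    using assms(1,4) that by (meson UN_upper finite_subset)
  then have "\<forall>i\<in>{1..m}. \<exists>xs. set xs = C i \<and> distinct xs"
    using finite_distinct_list by blast
  then obtain docs where docs: "\<And>i. i \<in> {1..m} \<Longrightarrow> set (docs i) = C i \<and> distinct (docs i)"
    by metis
  define r where "r = fold (visit_cluster k s P P' docs) order []"
  have "disjoint_family_on (\<lambda>i. set (docs i)) (set order)"
    using assms(3) docs order(2) by (simp add: disjoint_family_on_def)
  then have r: "distinct r" "min k (\<Sum>i\<leftarrow>order. length (docs i)) \<le> length r"
    using visit_cluster_fold[of "[]" order docs k s P P'] order docs by (auto simp: r_def)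
  have "(\<Sum>i\<leftarrow>order. length (docs i)) = (\<Sum>i\<in>{1..m}. length (docs i))"
    using order sum_list_distinct_conv_sum_set by metis
  also have "\<dots> = (\<Sum>i\<in>{1..m}. card (C i))"
    using docs by (intro sum.cong refl) (metis distinct_card)
  also have "\<dots> = card D"
    using assms(3,4) fin card_UN_disjoint'[of C "{1..m}"] by simp
  finally have "k \<le> card (set r)"
    using r assms(2) distinct_card[of r] by simp
  then obtain L where "is_top_list k s (set r) L"
    using is_top_list_exists by blast
  then show ?thesis
    unfolding cluster_run_output_def r_def using order srt docs by blast
qed

end

theory Submission
  imports Defs
begin

text \<open>A document \<open>d\<close> is only ever pruned when \<open>\<mu> * RankScore(d) \<le> \<theta>\<close>, and then \<open>k\<close> documents of
  score at least \<open>\<theta>\<close> have already been scored. So, up to the factor \<open>\<mu>\<close>, every document of the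
  collection is either scored or dominated by \<open>k\<close> scored ones, which forces the \<open>j\<close>-th entry of
  the output to score at least \<open>\<mu>\<close> times the \<open>j\<close>-th entry of a rank-safe list.\<close>

section \<open>Coverage of every document during a run\<close>

text \<open>Depends only on the scored list, not on the threshold at the moment of pruning, and
  survives appending a document, so it serves as an invariant of the run. Entries are counted with
  multiplicity; distinctness of the list is brought in later.\<close>

definition covered :: "nat \<Rightarrow> ('d \<Rightarrow> real) \<Rightarrow> real \<Rightarrow> 'd list \<Rightarrow> 'd \<Rightarrow> bool" where
  "covered k s \<mu> xs d \<longleftrightarrow> d \<in> set xs \<or> k \<le> length (filter (\<lambda>e. \<mu> * s d \<le> s e) xs)"

lemma length_filter_threshold:
  assumes "1 \<le> k" and "k \<le> length xs"
  shows "k \<le> length (filter (\<lambda>e. threshold k s xs \<le> s e) xs)"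
proof -
  define ys where "ys = rev (sort (map s xs))"
  define \<theta> where "\<theta> = threshold k s xs"
  have len: "length ys = length xs" and \<theta>: "\<theta> = ys ! (k - 1)"
    by (simp_all add: ys_def \<theta>_def threshold_def)
  have desc: "sorted_wrt (\<ge>) ys"
    by (simp add: ys_def sorted_wrt_rev)
  have "\<theta> \<le> y" if y: "y \<in> set (take k ys)" for y
  proof -
    obtain i where i: "i < k" "i < length ys" "y = ys ! i"
      using y by (auto simp: in_set_conv_nth)
    show ?thesis
    proof (cases "i = k - 1")
      case False
      then show ?thesis
        using sorted_wrt_nth_less[OF desc, of i "k - 1"] i assms by (simp add: len \<theta>)
    qed (simp add: i \<theta>)
  qed
  then have "k = length (filter (\<lambda>y. \<theta> \<le> y) (take k ys))"
    using assms len by (simp add: filter_id_conv)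
  also have "\<dots> \<le> length (filter (\<lambda>y. \<theta> \<le> y) (take k ys @ drop k ys))"
    unfolding filter_append by simp
  \<comment> \<open>Filtering commutes with \<open>rev\<close>, \<open>sort\<close> and
    \<open>map\<close>, so the count moves from the sorted scores back to the documents.\<close>
  also have "\<dots> = length (filter (\<lambda>e. \<theta> \<le> s e) xs)"
    by (simp add: ys_def rev_filter[symmetric] filter_sort filter_map o_def)
  finally show ?thesis
    by (simp add: \<theta>_def)
qed

text \<open>Lowering the cutoff from the threshold to \<open>\<mu> * s d\<close> can only enlarge
  the filtered list. This turns a pruning decision, on a document or on a whole cluster, into
  coverage.\<close>

lemma covered_threshold:
  assumes "1 \<le> k" and "k \<le> length xs" and "\<mu> * s d \<le> threshold k s xs"
  shows "covered k s \<mu> xs d"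
proof -
  have "length (filter (\<lambda>e. \<theta> \<le> s e) ys) \<le> length (filter (\<lambda>e. \<mu> * s d \<le> s e) ys)"
    if "\<mu> * s d \<le> \<theta>" for \<theta> ys
    using that by (induction ys) auto
  from this[OF assms(3), of xs]
  have "length (filter (\<lambda>e. threshold k s xs \<le> s e) xs) \<le> length (filter (\<lambda>e. \<mu> * s d \<le> s e) xs)" .
  then show ?thesis
    using length_filter_threshold[OF assms(1,2), of s] by (simp add: covered_def)
qed

text \<open>At its own turn a document is either scored or pruned, hence covered by
  \<open>covered_threshold\<close>; later steps preserve coverage.\<close>

lemma covered_fold_consider_doc:
  assumes "1 \<le> k"
    and "\<And>d \<theta>. d \<in> set ds \<Longrightarrow> P d \<theta> \<Longrightarrow> \<mu> * s d \<le> \<theta>"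
    and "covered k s \<mu> xs d \<or> d \<in> set ds"
  shows "covered k s \<mu> (fold (consider_doc k s P) ds xs) d"
  using assms(2,3)
proof (induction ds arbitrary: xs)
  case (Cons e ds)
  have "covered k s \<mu> (consider_doc k s P e xs) e"
    using covered_threshold[OF assms(1), of xs \<mu> s e] Cons.prems(1)[of e]
    by (cases "k \<le> length xs \<and> P e (threshold k s xs)")
      (auto simp: consider_doc_def covered_def)
  moreover have "covered k s \<mu> (consider_doc k s P e xs) d" if "covered k s \<mu> xs d"
    using that by (auto simp: consider_doc_def covered_def)
  ultimately have "covered k s \<mu> (consider_doc k s P e xs) d \<or> d \<in> set ds"
    using Cons.prems(2) by auto
  then show ?case
    using Cons.IH Cons.prems(1) by simp
qed simp

text \<open>Pruning a cluster covers all its documents at once, since the cluster rule bounds each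
  of their scores; in any other cluster they become covered one after another.\<close>

lemma covered_fold_visit_cluster:
  assumes "1 \<le> k"
    and "\<And>i d \<theta>. i \<in> set order \<Longrightarrow> d \<in> set (docs i) \<Longrightarrow> P i \<theta> \<Longrightarrow> \<mu> * s d \<le> \<theta>"
    and "\<And>i d \<theta>. i \<in> set order \<Longrightarrow> d \<in> set (docs i) \<Longrightarrow> P' d \<theta> \<Longrightarrow> \<mu> * s d \<le> \<theta>"
    and "covered k s \<mu> xs d \<or> (\<exists>i\<in>set order. d \<in> set (docs i))"
  shows "covered k s \<mu> (fold (visit_cluster k s P P' docs) order xs) d"
  using assms(2-)
proof (induction order arbitrary: xs)
  case (Cons i order)
  have "covered k s \<mu> (visit_cluster k s P P' docs i xs) d"
    if d: "covered k s \<mu> xs d \<or> d \<in> set (docs i)"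
  proof (cases "k \<le> length xs \<and> P i (threshold k s xs)")
    case True
    then show ?thesis
      using d covered_threshold[OF assms(1), of xs \<mu> s d]
        Cons.prems(1)[of i d "threshold k s xs"]
      by (auto simp: visit_cluster_def)
  next
    case False
    have "covered k s \<mu> (fold (consider_doc k s P') (docs i) xs) d"
      by (rule covered_fold_consider_doc[OF assms(1) _ d]) (use Cons.prems(2) in auto)
    then show ?thesis
      using False by (auto simp: visit_cluster_def)
  qed
  then have "covered k s \<mu> (visit_cluster k s P P' docs i xs) d
      \<or> (\<exists>i\<in>set order. d \<in> set (docs i))"
    using Cons.prems(3) by auto
  moreover have "\<mu> * s d \<le> \<theta>" if "i \<in> set order" "d \<in> set (docs i)" "P i \<theta>" for i d \<theta>
    using Cons.prems(1)[of i d \<theta>] that by simp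
  moreover have "\<mu> * s d \<le> \<theta>" if "i \<in> set order" "d \<in> set (docs i)" "P' d \<theta>" for i d \<theta>
    using Cons.prems(2)[of i d \<theta>] that by simp
  ultimately have "covered k s \<mu>
      (fold (visit_cluster k s P P' docs) order (visit_cluster k s P P' docs i xs)) d"
    by (intro Cons.IH)
  then show ?case
    by simp
qed simp

section \<open>Comparing the output with a rank-safe list, entrywise and on average\<close>

text \<open>An element scoring strictly more than \<open>L ! j\<close> cannot lie outside
  \<open>L\<close>, and by sortedness it stands at an index below \<open>j\<close>. Strictness makes
  ties harmless.\<close>

lemma top_list_card_greater:
  assumes "is_top_list k s X L" and "j < k"
  shows "card {e \<in> X. s (L ! j) < s e} \<le> j"
proof -
  have L: "length L = k" "sorted_wrt (\<lambda>d e. s d \<ge> s e) L"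
    "\<And>d e. d \<in> set L \<Longrightarrow> e \<in> X - set L \<Longrightarrow> s e \<le> s d"
    using assms(1) by (auto simp: is_top_list_def)
  have "{e \<in> X. s (L ! j) < s e} \<subseteq> set (take j L)"
  proof
    fix e assume "e \<in> {e \<in> X. s (L ! j) < s e}"
    then have e: "e \<in> X" "s (L ! j) < s e"
      by auto
    then have "e \<in> set L"
      using L(1) L(3)[of "L ! j" e] assms(2) by force
    then obtain i where i: "i < k" "e = L ! i"
      by (metis L(1) in_set_conv_nth)
    have "i < j"
    proof (rule ccontr)
      assume "\<not> i < j"
      then have "s (L ! i) \<le> s (L ! j)"
        using sorted_wrt_nth_less[OF L(2), of j i] i(1) L(1) by (cases "i = j") auto
      then show False
        using e(2) i(2) by simp
    qed
    then show "e \<in> set (take j L)"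
      using i L(1) by (auto simp: in_set_conv_nth)
  qed
  then have "card {e \<in> X. s (L ! j) < s e} \<le> card (set (take j L))"
    by (simp add: card_mono)
  also have "\<dots> \<le> j"
    using card_length[of "take j L"] by simp
  finally show ?thesis .
qed

text \<open>By counting: if the inequality failed, at most \<open>j\<close> scored documents would
  beat \<open>L ! j\<close>. But either the first \<open>j + 1\<close> entries of \<open>R\<close>
  are all scored and beat it, or one of them is unscored and its coverage supplies
  \<open>k > j\<close> scored documents that do.\<close>

lemma top_list_nth_approx:
  assumes "0 < \<mu>" and "\<mu> \<le> 1"
    and "\<And>d. d \<in> D \<Longrightarrow> 0 \<le> s d"
    and "is_top_list k s D R" and "is_top_list k s (set xs) L" and "distinct xs"
    and "\<And>d. d \<in> D \<Longrightarrow> covered k s \<mu> xs d"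
    and "j < k"
  shows "\<mu> * s (R ! j) \<le> s (L ! j)"
proof (rule ccontr)
  assume "\<not> \<mu> * s (R ! j) \<le> s (L ! j)"
  then have less: "s (L ! j) < \<mu> * s (R ! j)"
    by simp
  define G where "G = {e \<in> set xs. s (L ! j) < s e}"
  have G: "finite G" "card G \<le> j"
    using top_list_card_greater[OF assms(5,8)] by (simp_all add: G_def)
  have R: "length R = k" "distinct R" "set R \<subseteq> D" "sorted_wrt (\<lambda>d e. s d \<ge> s e) R"
    using assms(4) by (auto simp: is_top_list_def)
  define T where "T = set (take (Suc j) R)"
  have T: "card T = Suc j" "T \<subseteq> D"
    using R assms(8) set_take_subset[of "Suc j" R] by (auto simp: T_def distinct_card)
  have ge: "s (R ! j) \<le> s d" if d: "d \<in> T" for d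
  proof -
    obtain i where i: "i \<le> j" "d = R ! i"
      using d by (auto simp: T_def in_set_conv_nth less_Suc_eq_le)
    then show ?thesis
      using sorted_wrt_nth_less[OF R(4), of i j] R(1) assms(8) by (cases "i = j") auto
  qed
  show False
  proof (cases "T \<subseteq> set xs")
    case True
    have "T \<subseteq> G"
    proof
      fix d assume d: "d \<in> T"
      have "R ! j \<in> D"
        using R(1,3) assms(8) nth_mem by blast
      \<comment> \<open>Scaling by \<open>\<mu> \<le> 1\<close> lowers the score because scores are
        nonnegative.\<close>
      then have "\<mu> * s (R ! j) \<le> s (R ! j)"
        using assms(1,2,3) by (simp add: mult_left_le_one_le)
      then show "d \<in> G"
        using True d ge[OF d] less by (auto simp: G_def)
    qed
    then have "card T \<le> card G"
      using G(1) by (simp add: card_mono)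
    then show False
      using T(1) G(2) by simp
  next
    case False
    then obtain d where d: "d \<in> T" "d \<notin> set xs"
      by auto
    \<comment> \<open>The documents covering \<open>d\<close> score at least
      \<open>\<mu> * s d\<close>, hence more than \<open>L ! j\<close>.\<close>
    have "s (L ! j) < \<mu> * s d"
      using less ge[OF d(1)] assms(1) mult_left_mono[of "s (R ! j)" "s d" \<mu>] by linarith
    then have "set (filter (\<lambda>e. \<mu> * s d \<le> s e) xs) \<subseteq> G"
      by (auto simp: G_def)
    then have "card (set (filter (\<lambda>e. \<mu> * s d \<le> s e) xs)) \<le> card G"
      using G(1) by (rule card_mono[rotated])
    \<comment> \<open>Distinctness of \<open>xs\<close> turns the list count in
      \<open>covered\<close> into a cardinality.\<close>
    moreover have "k \<le> card (set (filter (\<lambda>e. \<mu> * s d \<le> s e) xs))"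
      using assms(6,7) d T(2)
      by (metis covered_def distinct_card distinct_filter subsetD)
    ultimately show False
      using G(2) assms(8) by simp
  qed
qed

lemma avg_score_mono:
  assumes "length R = k" and "length L = k" and "x \<le> k"
    and "\<And>j. j < k \<Longrightarrow> \<mu> * s (R ! j) \<le> s (L ! j)"
  shows "\<mu> * avg_score s x R \<le> avg_score s x L"
proof -
  have avg: "avg_score s x M = (\<Sum>j<x. s (M ! j)) / real x" if "length M = k" for M
    using that assms(3) by (simp add: avg_score_def sum_list_sum_nth atLeast0LessThan)
  have "(\<Sum>j<x. \<mu> * s (R ! j)) \<le> (\<Sum>j<x. s (L ! j))"
    using assms(3,4) by (intro sum_mono) simp
  then have "(\<Sum>j<x. \<mu> * s (R ! j)) / real x \<le> (\<Sum>j<x. s (L ! j)) / real x"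
    by (rule divide_right_mono) simp
  then show ?thesis
    using assms(1,2) by (simp add: avg sum_distrib_left)
qed

text \<open>Common core for both algorithms: each pruning rule enters only through the guarantee
  that what it discards satisfies \<open>\<mu> * s d \<le> \<theta>\<close>.\<close>

lemma cluster_run_avg_score:
  assumes "0 < \<mu>" and "\<mu> \<le> 1" and "1 \<le> k" and "x \<le> k"
    and "\<And>d. d \<in> D \<Longrightarrow> 0 \<le> s d"
    and "disjoint_family_on C {1..m}" and "(\<Union>i\<in>{1..m}. C i) = D"
    and "\<And>i d \<theta>. i \<in> {1..m} \<Longrightarrow> d \<in> C i \<Longrightarrow> P i \<theta> \<Longrightarrow> \<mu> * s d \<le> \<theta>"
    and "\<And>d \<theta>. d \<in> D \<Longrightarrow> P' d \<theta> \<Longrightarrow> \<mu> * s d \<le> \<theta>"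
    and "is_top_list k s D R" and "cluster_run_output k s m C est P P' L"
  shows "\<mu> * avg_score s x R \<le> avg_score s x L"
proof -
  obtain order docs where order: "distinct order" "set order = {1..m}"
    and docs: "\<And>i. i \<in> {1..m} \<Longrightarrow> distinct (docs i) \<and> set (docs i) = C i"
    and L: "is_top_list k s (set (fold (visit_cluster k s P P' docs) order [])) L"
    using assms(11) unfolding cluster_run_output_def by blast
  define xs where "xs = fold (visit_cluster k s P P' docs) order []"
  \<comment> \<open>Disjoint clusters ensure that no document is scored twice.\<close>
  have "disjoint_family_on (\<lambda>i. set (docs i)) (set order)"
    using assms(6) docs order(2) by (simp add: disjoint_family_on_def)
  then have dist: "distinct xs"
    using visit_cluster_fold[of "[]" order docs k s P P'] order docs by (simp add: xs_def)
  have cov: "covered k s \<mu> xs d" if "d \<in> D" for d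
    unfolding xs_def
  proof (rule covered_fold_visit_cluster[OF assms(3)])
    show "covered k s \<mu> [] d \<or> (\<exists>i\<in>set order. d \<in> set (docs i))"
      using that assms(7) order(2) docs by auto
  next
    show "\<mu> * s d \<le> \<theta>" if "i \<in> set order" "d \<in> set (docs i)" "P i \<theta>" for i d \<theta>
      using that assms(8) order(2) docs by simp
    show "\<mu> * s d \<le> \<theta>" if "i \<in> set order" "d \<in> set (docs i)" "P' d \<theta>" for i d \<theta>
      using that assms(7) order(2) docs by (intro assms(9)) auto
  qed
  show ?thesis
  proof (rule avg_score_mono)
    show "\<mu> * s (R ! j) \<le> s (L ! j)" if "j < k" for j
      by (rule top_list_nth_approx[OF assms(1,2,5,10) _ dist cov that])
        (use L in \<open>simp_all add: xs_def\<close>)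
  qed (use assms(4,10) L in \<open>auto simp: is_top_list_def\<close>)
qed

section \<open>Cluster bounds and the concrete pruning rules\<close>

text \<open>Holds term by term; \<open>X\<close> contains \<open>d\<close>, so
  \<open>max_weight\<close> is a genuine \<open>Max\<close> and not the default 0.\<close>

lemma rank_score_le_bound_sum:
  assumes "finite X" and "d \<in> X"
  shows "rank_score Q w d \<le> bound_sum Q w X"
  unfolding rank_score_def bound_sum_def
  using assms by (intro sum_mono) (auto simp: max_weight_def intro!: Max_ge)

lemma bound_sum_le_max_sbound:
  assumes "j \<in> {1..n}"
  shows "bound_sum Q w (Si j) \<le> max_sbound Q w n Si"
  unfolding max_sbound_def using assms by (intro Max_ge) auto

theorem proposition3:
  fixes D :: "'d set" and Q :: "'t set" and w :: "'t \<Rightarrow> 'd \<Rightarrow> real"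
    and C :: "nat \<Rightarrow> 'd set" and S :: "nat \<Rightarrow> nat \<Rightarrow> 'd set"
    and bound_asc bound_any :: "'d \<Rightarrow> real"
    and \<mu> \<eta> :: real and k k' m n :: nat
    and L_asc L_any L_R :: "'d list"
  assumes "0 < \<mu>" and "\<mu> \<le> \<eta>" and "\<eta> \<le> 1"
    and "1 \<le> k" and "1 \<le> k'" and "k' \<le> k"
    and "finite D" and "k \<le> card D"
    and "finite Q"
    and "\<And>t d. d \<in> D \<Longrightarrow> 0 \<le> w t d"
    and "\<And>i. i \<in> {1..m} \<Longrightarrow> C i \<noteq> {}"
    and "disjoint_family_on C {1..m}"
    and "(\<Union>i\<in>{1..m}. C i) = D"
    and "1 \<le> n"
    and "\<And>i. i \<in> {1..m} \<Longrightarrow> disjoint_family_on (S i) {1..n}"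
    and "\<And>i. i \<in> {1..m} \<Longrightarrow> (\<Union>j\<in>{1..n}. S i j) = C i"
    and "\<And>d. d \<in> D \<Longrightarrow> rank_score Q w d \<le> bound_asc d"
    and "\<And>d. d \<in> D \<Longrightarrow> rank_score Q w d \<le> bound_any d"
    and "is_top_list k (rank_score Q w) D L_R"
    and "asc_output k \<mu> \<eta> Q w bound_asc m C n S L_asc"
    and "anytime_output k \<mu> Q w bound_any m C L_any"
  shows "avg_score (rank_score Q w) k' L_asc \<ge> \<mu> * avg_score (rank_score Q w) k' L_R \<and>
         avg_score (rank_score Q w) k' L_any \<ge> \<mu> * avg_score (rank_score Q w) k' L_R"
proof -
  let ?s = "rank_score Q w"
  have nonneg: "0 \<le> ?s d" if "d \<in> D" for d
    using that assms(10) by (simp add: rank_score_def sum_nonneg)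
  have fin: "finite (C i)" if "i \<in> {1..m}" for i
    using that assms(7,13) by (meson UN_upper finite_subset)
  have any: "\<mu> * ?s d \<le> \<theta>" if "?s d \<le> b" "b \<le> \<theta> / \<mu>" for d b \<theta>
    using order_trans[OF that] assms(1) by (simp add: pos_le_divide_eq mult.commute)
  \<comment> \<open>The document rule of ASC divides by \<open>\<eta>\<close>; since scores are
    nonnegative, \<open>\<mu> \<le> \<eta>\<close> brings the estimate back to
    \<open>\<mu>\<close>.\<close>
  have asc: "\<mu> * ?s d \<le> \<theta>" if "d \<in> D" "?s d \<le> b" "b \<le> \<theta> / \<eta>" for d b \<theta>
  proof -
    have "\<mu> * ?s d \<le> \<eta> * ?s d"
      using assms(2) nonneg[OF that(1)] by (rule mult_right_mono)
    also have "\<dots> \<le> \<theta>"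
      using order_trans[OF that(2,3)] assms(1,2) by (simp add: pos_le_divide_eq mult.commute)
    finally show ?thesis .
  qed
  \<comment> \<open>The bound of the one segment containing \<open>d\<close> dominates its score,
    and \<open>max_sbound\<close> dominates that bound.\<close>
  have max_sbound: "?s d \<le> max_sbound Q w n (S i)" if i: "i \<in> {1..m}" and d: "d \<in> C i" for i d
  proof -
    obtain j where j: "j \<in> {1..n}" "d \<in> S i j"
      using d assms(16)[OF i] by blast
    then have "finite (S i j)"
      using assms(16)[OF i] fin[OF i] j(1) by (metis UN_upper finite_subset)
    then have "?s d \<le> bound_sum Q w (S i j)"
      using j(2) by (rule rank_score_le_bound_sum)
    also have "\<dots> \<le> max_sbound Q w n (S i)"
      using j(1) by (rule bound_sum_le_max_sbound)
    finally show ?thesis .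
  qed
  have "\<mu> \<le> 1"
    using assms(2,3) by simp
  \<comment> \<open>Fixes the data shared by both algorithms; the guarantees for the cluster rule
    and the document rule are supplied for each algorithm below.\<close>
  note run = cluster_run_avg_score[OF assms(1) this assms(4,6) nonneg assms(12,13) _ _ assms(19)]
  have "\<mu> * avg_score ?s k' L_R \<le> avg_score ?s k' L_asc"
  proof (rule run[OF _ _ _ assms(20)[unfolded asc_output_def]])
    show "\<mu> * ?s d \<le> \<theta>"
      if "i \<in> {1..m}" "d \<in> C i"
        "max_sbound Q w n (S i) \<le> \<theta> / \<mu> \<and> avg_sbound Q w n (S i) \<le> \<theta> / \<eta>" for i d \<theta>
      using any[OF max_sbound[OF that(1,2)]] that(3) by simp
    show "\<mu> * ?s d \<le> \<theta>" if "d \<in> D" "bound_asc d \<le> \<theta> / \<eta>" for d \<theta>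
      using asc[OF that(1) assms(17)[OF that(1)] that(2)] .
  qed
  moreover have "\<mu> * avg_score ?s k' L_R \<le> avg_score ?s k' L_any"
  proof (rule run[OF _ _ _ assms(21)[unfolded anytime_output_def]])
    show "\<mu> * ?s d \<le> \<theta>"
      if "i \<in> {1..m}" "d \<in> C i" "bound_sum Q w (C i) \<le> \<theta> / \<mu>" for i d \<theta>
      using any[OF rank_score_le_bound_sum[OF fin[OF that(1)] that(2)] that(3)] .
    show "\<mu> * ?s d \<le> \<theta>" if "d \<in> D" "bound_any d \<le> \<theta> / \<mu>" for d \<theta>
      using any[OF assms(18)[OF that(1)] that(2)] .
  qed
  ultimately show ?thesis
    by simp
qed

end
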